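(* The fourth smallest distance Pareto eigenvalue of every connected non-complete graph $G$ is $1+\sqrt{3}$; that is, $\mu_4(G)=1+\sqrt3$.
   Context: All graphs are finite, undirected, simple and connected. The distance matrix $\mathcal{D}(G)$ of a graph $G$ on vertices $1,\dots,n$ is the $n\times n$ matrix whose $(i,j)$ entry is the length of a shortest path from $i$ to $j$. A real number $\lambda$ is a Pareto eigenvalue of a real $n\times n$ matrix $A$ if there is a nonzero vector $\mathbf{x}\in\mathbb{R}^n$, $\mathbf{x}\ge 0$ (entrywise), with $A\mathbf{x}\ge\lambda\mathbf{x}$ (entrywise) and $\lambda=\frac{\mathbf{x}^TA\mathbf{x}}{\mathbf{x}^T\mathbf{x}}$. The distance Pareto eigenvalues of $G$ are the Pareto eigenvalues of $\mathcal{D}(G)$. $\mu_k(G)$ denotes the $k$-th smallest element of the set of distinct distance Pareto eigenvalues of $G$. *)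

theory Defs
  imports
    "HOL-Analysis.Analysis"
    "Graph_Theory.Graph_Theory"
begin

text \<open>
  A finite simple undirected graph is a symmetric loop-free pair digraph
  (\<open>pair_graph\<close>).  Its vertex set is all of a finite type \<open>'n\<close>, so that
  matrices indexed by the vertices are elements of \<open>real ^ 'n ^ 'n\<close>.
\<close>

definition graph_dist :: "'a pair_pre_digraph \<Rightarrow> 'a \<Rightarrow> 'a \<Rightarrow> nat" where
  "graph_dist G u v = (LEAST k. \<exists>p. pre_digraph.apath (with_proj G) u p v \<and> length p = k)"

definition distance_matrix :: "'n::finite pair_pre_digraph \<Rightarrow> real ^ 'n ^ 'n" where
  "distance_matrix G = (\<chi> i j. real (graph_dist G i j))"

text \<open>The order on \<open>real ^ 'n\<close> is the entrywise one.\<close>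

definition pareto_eigenvalue :: "real ^ 'n ^ 'n \<Rightarrow> real \<Rightarrow> bool" where
  "pareto_eigenvalue A l \<longleftrightarrow>
     (\<exists>x. x \<noteq> 0 \<and> 0 \<le> x \<and> l *\<^sub>R x \<le> A *v x \<and> l = (x \<bullet> (A *v x)) / (x \<bullet> x))"

definition distance_pareto_eigenvalues :: "'n::finite pair_pre_digraph \<Rightarrow> real set" where
  "distance_pareto_eigenvalues G = {l. pareto_eigenvalue (distance_matrix G) l}"

text \<open>Meaningful for \<open>k \<ge> 1\<close>: the smallest element is the first one.\<close>

definition is_kth_smallest :: "nat \<Rightarrow> real set \<Rightarrow> real \<Rightarrow> bool" where
  "is_kth_smallest k S x \<longleftrightarrow> x \<in> S \<and> finite {y \<in> S. y \<le> x} \<and> card {y \<in> S. y \<le> x} = k"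

text \<open>There is at most one \<open>k\<close>-th smallest element; if there is none, the value is unspecified.\<close>

definition pareto_mu :: "nat \<Rightarrow> 'n::finite pair_pre_digraph \<Rightarrow> real" where
  "pareto_mu k G = (THE x. is_kth_smallest k (distance_pareto_eigenvalues G) x)"

end

theory Submission
  imports Defs
begin

text \<open>
  Complementarity shows that the Pareto eigenvalues of an entrywise nonnegative matrix are the
  eigenvalues with a positive eigenvector of its principal submatrices.  For a distance matrix, a
  submatrix of order 1 contributes 0, one of order 2 contributes a distance, and one of order at
  least 4 has off-diagonal row sums at least 3, hence contributes at least \<open>3 > 1 + sqrt 3\<close>.
  A submatrix of order 3 contributes 2 if all three distances are 1; otherwise its eigenvalue is
  at least that of the distance matrix of the path on three vertices, which is \<open>1 + sqrt 3\<close>.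
  A connected non-complete graph contains an induced path on three vertices, so
  the values up to \<open>1 + sqrt 3\<close> are exactly 0, 1, 2 and \<open>1 + sqrt 3\<close>.
\<close>

section \<open>Reduction to principal submatrices\<close>

lemma pareto_eigenvalue_iff_principal_submatrix:
  fixes A :: "real ^ 'n::finite ^ 'n"
  assumes nonneg: "\<And>i j. 0 \<le> A $ i $ j"
  shows "pareto_eigenvalue A l \<longleftrightarrow>
    (\<exists>S x. S \<noteq> {} \<and> (\<forall>i\<in>S. 0 < x i \<and> (\<Sum>j\<in>S. A $ i $ j * x j) = l * x i))"
proof
  assume "pareto_eigenvalue A l"
  then obtain x where x: "x \<noteq> 0" "0 \<le> x" "l *\<^sub>R x \<le> A *v x"
      and l: "l = (x \<bullet> (A *v x)) / (x \<bullet> x)"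
    unfolding pareto_eigenvalue_def by auto
  define S where "S = {i. x $ i \<noteq> 0}"
  have pos: "0 < x $ i" if "i \<in> S" for i
    using that x(2) by (auto simp: S_def less_eq_vec_def less_le)
  have "x \<bullet> (A *v x) = l * (x \<bullet> x)" using l x(1) by simp
  \<comment> \<open>Complementarity: these terms are nonnegative and add up to zero, so each of them
    vanishes.\<close>
  then have "(\<Sum>i\<in>UNIV. x $ i * ((A *v x) $ i - l * x $ i)) = 0"
    by (simp add: inner_vec_def sum_distrib_left algebra_simps sum_subtractf)
  moreover have "0 \<le> x $ i * ((A *v x) $ i - l * x $ i)" for i
    using x by (auto simp: less_eq_vec_def)
  ultimately have "x $ i * ((A *v x) $ i - l * x $ i) = 0" for i
    by (simp add: sum_nonneg_eq_0_iff)
  then have "(A *v x) $ i = l * x $ i" if "i \<in> S" for i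
    using that by (auto simp: S_def)
  moreover have "(A *v x) $ i = (\<Sum>j\<in>S. A $ i $ j * x $ j)" for i
    unfolding matrix_vector_mult_def S_def by (auto intro!: sum.mono_neutral_right)
  moreover have "S \<noteq> {}" using x(1) by (auto simp: S_def vec_eq_iff)
  ultimately show "\<exists>S x. S \<noteq> {} \<and> (\<forall>i\<in>S. 0 < x i \<and> (\<Sum>j\<in>S. A $ i $ j * x j) = l * x i)"
    using pos by (intro exI[of _ S] exI[of _ "($) x"]) simp
next
  assume "\<exists>S x. S \<noteq> {} \<and> (\<forall>i\<in>S. 0 < x i \<and> (\<Sum>j\<in>S. A $ i $ j * x j) = l * x i)"
  then obtain S x where S: "S \<noteq> {}" and pos: "\<And>i. i \<in> S \<Longrightarrow> 0 < x i"
      and eig: "\<And>i. i \<in> S \<Longrightarrow> (\<Sum>j\<in>S. A $ i $ j * x j) = l * x i"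
    by blast
  \<comment> \<open>Extension of the eigenvector by zero outside \<open>S\<close>.\<close>
  define y :: "real ^ 'n" where "y = (\<chi> i. if i \<in> S then x i else 0)"
  have Ay: "(A *v y) $ i = (\<Sum>j\<in>S. A $ i $ j * x j)" for i
    unfolding matrix_vector_mult_def y_def by (auto intro!: sum.mono_neutral_cong_right)
  obtain i where "i \<in> S" using S by blast
  then have "y $ i \<noteq> 0" using pos[of i] by (simp add: y_def)
  then have "y \<noteq> 0" by auto
  moreover have "0 \<le> y" using pos by (auto simp: y_def less_eq_vec_def less_imp_le)
  moreover have "l *\<^sub>R y \<le> A *v y"
    unfolding less_eq_vec_def
  proof
    fix i
    show "(l *\<^sub>R y) $ i \<le> (A *v y) $ i"
    proof (cases "i \<in> S")
      case True
      then show ?thesis by (simp add: Ay eig) (simp add: y_def)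
    next
      \<comment> \<open>Here the left side is 0, and nonnegativity of \<open>A\<close> gives the
        inequality.\<close>
      case False
      have "0 \<le> (\<Sum>j\<in>S. A $ i $ j * x j)"
        using pos nonneg by (intro sum_nonneg mult_nonneg_nonneg) (auto simp: less_imp_le)
      with False show ?thesis by (simp add: Ay) (simp add: y_def)
    qed
  qed
  moreover have "y \<bullet> (A *v y) = l * (y \<bullet> y)"
    unfolding inner_vec_def sum_distrib_left
    by (rule sum.cong) (simp_all add: Ay, simp add: y_def eig)
  ultimately show "pareto_eigenvalue A l"
    unfolding pareto_eigenvalue_def by (intro exI[of _ y]) auto
qed

section \<open>Lower bounds for submatrices of order 3 and higher\<close>

lemma one_plus_sqrt3_le_iff:
  fixes l :: real
  assumes "0 \<le> l"
  shows "1 + sqrt 3 \<le> l \<longleftrightarrow> 2 * l + 2 \<le> l\<^sup>2"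
proof -
  have "1 + sqrt 3 \<le> l \<longleftrightarrow> 1 \<le> l \<and> sqrt 3 \<le> l - 1"
  proof -
    have "0 \<le> sqrt (3 :: real)" by simp
    then show ?thesis by linarith
  qed
  also have "\<dots> \<longleftrightarrow> 1 \<le> l \<and> 3 \<le> (l - 1)\<^sup>2"
    using real_sqrt_le_iff[of 3 "(l - 1)\<^sup>2"] by auto
  also have "\<dots> \<longleftrightarrow> 2 * l + 2 \<le> l\<^sup>2"
  proof -
    \<comment> \<open>This rules out the other branch, \<open>l \<le> 1 - sqrt 3\<close>, of the
      quadratic inequality.\<close>
    have "1 \<le> l" if "2 * l + 2 \<le> l\<^sup>2"
    proof (rule ccontr)
      assume "\<not> 1 \<le> l"
      then have "l * l \<le> 1 * l" using assms by (intro mult_right_mono) auto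
      with that assms show False by (simp add: power2_eq_square)
    qed
    then show ?thesis by (auto simp: power2_diff)
  qed
  finally show ?thesis .
qed

lemma one_plus_sqrt3_less_3: "1 + sqrt 3 < 3"
  using real_sqrt_less_iff[of 3 4] by simp

text \<open>The path has centre \<open>a\<close> and ends \<open>b\<close>, \<open>c\<close>.
  Merging the ends into \<open>s = b + c\<close> leaves the matrix with rows (0, 1) and (2, 2),
  whose characteristic polynomial \<open>l^2 - 2 * l - 2\<close> has largest root
  \<open>1 + sqrt 3\<close>.\<close>

lemma path3_eigenvalue_le:
  fixes a b c l :: real
  assumes "0 < a" "0 < b" "0 < c"
    and "b + c \<le> l * a" "a + 2 * c \<le> l * b" "a + 2 * b \<le> l * c"
  shows "1 + sqrt 3 \<le> l"
proof -
  define s where "s = b + c"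
  have s: "0 < s" "s \<le> l * a" "2 * a + 2 * s \<le> l * s"
    using assms by (auto simp: s_def algebra_simps)
  have "0 < l" using s(1,2) assms(1) by (smt (verit) mult_nonneg_nonneg zero_less_mult_pos2)
  \<comment> \<open>Multiplying the last inequality by \<open>l\<close> and using
    \<open>s \<le> l * a\<close> eliminates \<open>a\<close>.\<close>
  have "s * (2 * l + 2) \<le> l * (2 * a + 2 * s)" using s(2) by (simp add: algebra_simps)
  also have "\<dots> \<le> l * (l * s)" using s(3) \<open>0 < l\<close> by (intro mult_left_mono) auto
  finally have "2 * l + 2 \<le> l\<^sup>2" using s(1) by (simp add: power2_eq_square mult.commute)
  then show ?thesis using \<open>0 < l\<close> by (simp add: one_plus_sqrt3_le_iff)
qed

text \<open>Since the vector is positive, lowering one entry that is at least 2 to 2 and the other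
  two to 1 turns the equations into the inequalities of the path.\<close>

lemma order3_eigenvalue:
  fixes a b c l :: real and p q r :: nat
  assumes pos: "0 < a" "0 < b" "0 < c" and pqr: "1 \<le> p" "1 \<le> q" "1 \<le> r"
    and eig: "real p * b + real q * c = l * a" "real p * a + real r * c = l * b"
      "real q * a + real r * b = l * c"
  shows "l = 2 \<or> 1 + sqrt 3 \<le> l"
proof -
  have ge1: "y \<le> real m * y" if "1 \<le> m" "0 < y" for m :: nat and y
    using that by simp
  have ge2: "2 * y \<le> real m * y" if "m \<noteq> 1" "1 \<le> m" "0 < y" for m :: nat and y
    using that by (intro mult_right_mono) auto
  consider "p = 1" "q = 1" "r = 1" | "p \<noteq> 1" | "q \<noteq> 1" | "r \<noteq> 1" by auto
  then show ?thesis
  proof cases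
    case 1
    then have "2 * (a + b + c) = l * a + l * b + l * c"
      unfolding eig[symmetric] by simp
    then have "(l - 2) * (a + b + c) = 0" by (simp add: algebra_simps)
    moreover have "a + b + c \<noteq> 0" using pos by simp
    ultimately show ?thesis by simp
  next
    case 2
    \<comment> \<open>The entry \<open>p\<close> links \<open>a\<close> and \<open>b\<close>, so
      these are the ends and \<open>c\<close> is the centre; the next two cases are
      analogous.\<close>
    have "1 + sqrt 3 \<le> l"
      by (rule path3_eigenvalue_le[of c a b])
        (use eig pos ge1[OF pqr(2) pos(1)] ge1[OF pqr(2) pos(3)] ge1[OF pqr(3) pos(2)]
        ge1[OF pqr(3) pos(3)] ge2[OF 2 pqr(1) pos(1)] ge2[OF 2 pqr(1) pos(2)] in linarith)+
    then show ?thesis ..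
  next
    case 3
    have "1 + sqrt 3 \<le> l"
      by (rule path3_eigenvalue_le[of b a c])
        (use eig pos ge1[OF pqr(1) pos(1)] ge1[OF pqr(1) pos(2)] ge1[OF pqr(3) pos(2)]
        ge1[OF pqr(3) pos(3)] ge2[OF 3 pqr(2) pos(1)] ge2[OF 3 pqr(2) pos(3)] in linarith)+
    then show ?thesis ..
  next
    case 4
    have "1 + sqrt 3 \<le> l"
      by (rule path3_eigenvalue_le[of a b c])
        (use eig pos ge1[OF pqr(1) pos(1)] ge1[OF pqr(1) pos(2)] ge1[OF pqr(2) pos(1)]
        ge1[OF pqr(2) pos(3)] ge2[OF 4 pqr(3) pos(2)] ge2[OF 4 pqr(3) pos(3)] in linarith)+
    then show ?thesis ..
  qed
qed

text \<open>Entrywise, \<open>M\<close> dominates the all-ones matrix minus the identity. Adding the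
  resulting row inequalities compares multiples of the positive sum of \<open>x\<close>.\<close>

lemma eigenvalue_ge_card_minus_1:
  fixes M :: "'n \<Rightarrow> 'n \<Rightarrow> real"
  assumes S: "finite S" "S \<noteq> {}"
    and M: "\<And>i j. i \<in> S \<Longrightarrow> j \<in> S \<Longrightarrow> 0 \<le> M i j"
      "\<And>i j. i \<in> S \<Longrightarrow> j \<in> S \<Longrightarrow> i \<noteq> j \<Longrightarrow> 1 \<le> M i j"
    and x: "\<And>i. i \<in> S \<Longrightarrow> 0 < x i"
    and eig: "\<And>i. i \<in> S \<Longrightarrow> (\<Sum>j\<in>S. M i j * x j) = l * x i"
  shows "real (card S) - 1 \<le> l"
proof -
  let ?s = "sum x S"
  have "?s - x i \<le> l * x i" if "i \<in> S" for i
  proof -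
    have "?s - x i = sum x (S - {i})" using S that by (simp add: sum_diff1)
    also have "\<dots> \<le> (\<Sum>j\<in>S - {i}. M i j * x j)"
    proof (rule sum_mono)
      fix j assume "j \<in> S - {i}"
      then show "x j \<le> M i j * x j"
        using M(2)[of i j] x[of j] that mult_right_mono[of 1 "M i j" "x j"] by auto
    qed
    also have "\<dots> \<le> (\<Sum>j\<in>S. M i j * x j)"
      using S M x that by (intro sum_mono2) (auto simp: less_imp_le)
    finally show ?thesis using eig that by simp
  qed
  then have "(\<Sum>i\<in>S. ?s - x i) \<le> (\<Sum>i\<in>S. l * x i)" by (rule sum_mono)
  then have "(real (card S) - 1) * ?s \<le> l * ?s"
    by (simp add: sum_subtractf sum_distrib_left[symmetric] algebra_simps)
  moreover have "0 < ?s" using S x by (intro sum_pos)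
  ultimately show ?thesis by simp
qed

section \<open>Pareto eigenvalues up to \<open>1 + sqrt 3\<close> of a symmetric natural-number
  matrix vanishing exactly on the diagonal\<close>

context
  fixes d :: "'n::finite \<Rightarrow> 'n \<Rightarrow> nat"
  assumes d_eq_0_iff: "\<And>i j. d i j = 0 \<longleftrightarrow> i = j"
    and d_sym: "\<And>i j. d i j = d j i"
begin

abbreviation (input) "dmat \<equiv> (\<chi> i j. real (d i j)) :: real ^ 'n ^ 'n"

lemma pareto_dmat_iff:
  "pareto_eigenvalue dmat l \<longleftrightarrow>
    (\<exists>S x. S \<noteq> {} \<and> (\<forall>i\<in>S. 0 < x i \<and> (\<Sum>j\<in>S. real (d i j) * x j) = l * x i))"
  by (subst pareto_eigenvalue_iff_principal_submatrix) auto

lemma pareto_dmat_small: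
  assumes "pareto_eigenvalue dmat l" "l \<le> 1 + sqrt 3"
  shows "l \<in> {0, 1, 2, 1 + sqrt 3}"
proof -
  obtain S :: "'n set" and x where S: "S \<noteq> {}" and x: "\<And>i. i \<in> S \<Longrightarrow> 0 < x i"
      and eig: "\<And>i. i \<in> S \<Longrightarrow> (\<Sum>j\<in>S. real (d i j) * x j) = l * x i"
    using assms(1) unfolding pareto_dmat_iff by blast
  have d0: "d i i = 0" for i by (simp add: d_eq_0_iff)
  have d1: "1 \<le> d i j" if "i \<noteq> j" for i j using d_eq_0_iff[of i j] that by auto
  have ge: "real (card S) - 1 \<le> l"
    using S x eig d1 by (intro eigenvalue_ge_card_minus_1[of S "\<lambda>i j. real (d i j)" x])
      (auto simp: Suc_le_eq)
  then have "card S < 4" using assms(2) one_plus_sqrt3_less_3 by linarith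
  moreover have "card S \<noteq> 0" using S by simp
  ultimately consider "card S = 1" | "card S = 2" | "card S = 3" by linarith
  then show ?thesis
  proof cases
    case 1
    then obtain i where "S = {i}" by (auto simp: card_1_singleton_iff)
    then show ?thesis using eig[of i] x[of i] by (simp add: d0)
  next
    case 2
    then obtain i j where ij: "S = {i, j}" "i \<noteq> j" by (auto simp: card_2_iff)
    have e: "real (d i j) * x j = l * x i" "real (d i j) * x i = l * x j"
      using eig[of i] eig[of j] ij by (simp_all add: d0 d_sym[of j i])
    \<comment> \<open>Adding the two rows cancels the unknown ratio of \<open>x i\<close> and
      \<open>x j\<close>.\<close>
    then have "real (d i j) * (x i + x j) = l * (x i + x j)" by (simp add: algebra_simps)
    then have l: "l = real (d i j)" using x[of i] x[of j] ij by simp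
    then have "d i j < 3" using assms(2) one_plus_sqrt3_less_3 by linarith
    with d1[OF ij(2)] have "d i j = 1 \<or> d i j = 2" by linarith
    then show ?thesis using l by auto
  next
    case 3
    then obtain i j k where ijk: "S = {i, j, k}" "i \<noteq> j" "i \<noteq> k" "j \<noteq> k"
      by (auto simp: card_3_iff)
    have "l = 2 \<or> 1 + sqrt 3 \<le> l"
      using ijk d1[OF ijk(2)] d1[OF ijk(3)] d1[OF ijk(4)] x eig[of i] eig[of j] eig[of k]
      by (intro order3_eigenvalue[of "x i" "x j" "x k" "d i j" "d i k" "d j k"])
        (auto simp: d0 d_sym[of j i] d_sym[of k i] d_sym[of k j])
    then show ?thesis using assms(2) by auto
  qed
qed

lemma pareto_dmat_0: "pareto_eigenvalue dmat 0"
  unfolding pareto_dmat_iff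
  \<comment> \<open>Any single index serves; \<open>undefined\<close> merely names one.\<close>
  by (intro exI[of _ "{undefined}"] exI[of _ "\<lambda>_. 1"]) (simp add: d_eq_0_iff)

lemma pareto_dmat_entry:
  assumes "i \<noteq> j"
  shows "pareto_eigenvalue dmat (real (d i j))"
proof -
  have "d i i = 0" "d j j = 0" by (simp_all add: d_eq_0_iff)
  then show ?thesis
    using assms unfolding pareto_dmat_iff
    by (intro exI[of _ "{i, j}"] exI[of _ "\<lambda>_. 1"]) (simp add: d_sym[of j i])
qed

lemma pareto_dmat_path3:
  assumes "d i j = 1" "d j k = 1" "d i k = 2"
  shows "pareto_eigenvalue dmat (1 + sqrt 3)"
proof -
  have d0: "d h h = 0" for h by (simp add: d_eq_0_iff)
  have ne: "i \<noteq> j" "j \<noteq> k" "i \<noteq> k" using assms by (auto simp: d0)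
  \<comment> \<open>With entry 1 at both ends, the row of the centre \<open>j\<close> forces the
    entry \<open>2 / (1 + sqrt 3) = sqrt 3 - 1\<close> there.\<close>
  show ?thesis
    unfolding pareto_dmat_iff
    using ne assms
    by (intro exI[of _ "{i, j, k}"] exI[of _ "\<lambda>h. if h = j then sqrt 3 - 1 else 1"])
      (auto simp: d0 d_sym[of j i] d_sym[of k j] d_sym[of k i] algebra_simps)
qed

end

section \<open>Graph distance and induced paths\<close>

lemma length_rev_path: "length (rev_path p) = length p"
  by (induction p) auto

context pair_graph
begin

lemma graph_dist_le:
  assumes "apath u p v"
  shows "graph_dist G u v \<le> length p"
  unfolding graph_dist_def using assms by (intro Least_le) blast

text \<open>Reachability ensures that the \<open>LEAST\<close> in \<open>graph_dist\<close> is
  attained by a path.\<close>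

lemma obtain_shortest_apath:
  assumes "u \<rightarrow>\<^sup>*\<^bsub>G\<^esub> v"
  obtains p where "apath u p v" "length p = graph_dist G u v"
proof -
  have "\<exists>k p. apath u p v \<and> length p = k" using assms reachable_apath by blast
  from LeastI_ex[OF this] show ?thesis using that unfolding graph_dist_def by blast
qed

text \<open>Reversing paths shows that both \<open>LEAST\<close> predicates coincide, which also
  covers unreachable pairs.\<close>

lemma graph_dist_sym: "graph_dist G u v = graph_dist G v u"
proof -
  have "\<exists>q. apath v q u \<and> length q = length p" if "apath u p v" for u v p
    using that by (intro exI[of _ "rev_path p"]) (simp add: length_rev_path)
  then have "(\<exists>p. apath u p v \<and> length p = k) \<longleftrightarrow> (\<exists>p. apath v p u \<and> length p = k)" for k
    by metis
  then show ?thesis unfolding graph_dist_def by simp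
qed

lemma graph_dist_eq_0_iff:
  assumes "u \<rightarrow>\<^sup>*\<^bsub>G\<^esub> v"
  shows "graph_dist G u v = 0 \<longleftrightarrow> u = v"
proof
  assume "graph_dist G u v = 0"
  then show "u = v" using obtain_shortest_apath[OF assms] by (auto simp: apath_Nil_iff)
next
  assume "u = v"
  then have "apath u [] v" using assms reachable_in_verts by (auto simp: apath_Nil_iff)
  then show "graph_dist G u v = 0" using graph_dist_le by fastforce
qed

lemma graph_dist_eq_1_iff:
  assumes "u \<rightarrow>\<^sup>*\<^bsub>G\<^esub> v"
  shows "graph_dist G u v = 1 \<longleftrightarrow> (u, v) \<in> parcs G"
proof
  assume "graph_dist G u v = 1"
  then obtain p where "apath u p v" "length p = 1" using obtain_shortest_apath[OF assms] by metis
  then show "(u, v) \<in> parcs G" by (auto simp: length_Suc_conv apath_simps)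
next
  assume uv: "(u, v) \<in> parcs G"
  then have "u \<noteq> v" using pair_no_loops by fastforce
  then have "apath u [(u, v)] v" using uv wellformed' by (auto simp: apath_simps)
  then have "graph_dist G u v \<le> 1" using graph_dist_le by fastforce
  then show "graph_dist G u v = 1"
    using graph_dist_eq_0_iff[OF assms] \<open>u \<noteq> v\<close> by linarith
qed

lemma graph_dist_eq_2I:
  assumes "(u, v) \<in> parcs G" "(v, w) \<in> parcs G" "(u, w) \<notin> parcs G" "u \<noteq> w"
  shows "graph_dist G u w = 2"
proof -
  \<comment> \<open>An \<open>apath\<close> must not repeat vertices.\<close>
  have "u \<noteq> v" "v \<noteq> w" using assms pair_no_loops by fastforce+
  then have p: "apath u [(u, v), (v, w)] w" using assms wellformed' by (auto simp: apath_simps)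
  then have "u \<rightarrow>\<^sup>*\<^bsub>G\<^esub> w" using reachable_apath by blast
  then have "graph_dist G u w \<noteq> 0" "graph_dist G u w \<noteq> 1"
    using assms graph_dist_eq_0_iff graph_dist_eq_1_iff by auto
  then show ?thesis using graph_dist_le[OF p] by simp
qed

lemma obtain_induced_path3:
  assumes "u \<rightarrow>\<^sup>*\<^bsub>G\<^esub> v" "u \<noteq> v" "(u, v) \<notin> parcs G"
  obtains (path) a b c where "(a, b) \<in> parcs G" "(b, c) \<in> parcs G" "(a, c) \<notin> parcs G" "a \<noteq> c"
proof (rule ccontr)
  assume "\<not> thesis"
  \<comment> \<open>Without an induced path on three vertices, "adjacent or equal" propagates along
    every walk from \<open>u\<close>.\<close>
  then have tr: "(a, c) \<in> parcs G \<or> a = c" if "(a, b) \<in> parcs G" "(b, c) \<in> parcs G" for a b c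
    using that path \<open>\<not> thesis\<close> by blast
  from assms(1) have "(u, v) \<in> parcs G \<or> u = v"
    by (induction rule: reachable_induct) (auto dest: tr)
  with assms show False by blast
qed

end

section \<open>The fourth smallest eigenvalue\<close>

lemma pareto_mu_eqI:
  assumes "is_kth_smallest k (distance_pareto_eigenvalues G) x"
  shows "pareto_mu k G = x"
proof -
  \<comment> \<open>A larger element has a strictly larger initial section, so two elements of the
    same rank coincide.\<close>
  have le: "\<not> y < z" if "is_kth_smallest k S y" "is_kth_smallest k S z" for S and y z :: real
  proof
    assume "y < z"
    moreover have "z \<in> S" using that by (simp add: is_kth_smallest_def)
    ultimately have "{t \<in> S. t \<le> y} \<subset> {t \<in> S. t \<le> z}" by force
    moreover have "finite {t \<in> S. t \<le> z}" using that by (simp add: is_kth_smallest_def)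
    ultimately have "card {t \<in> S. t \<le> y} < card {t \<in> S. t \<le> z}"
      by (intro psubset_card_mono)
    then show False using that by (simp add: is_kth_smallest_def)
  qed
  have "y = x" if "is_kth_smallest k (distance_pareto_eigenvalues G) y" for y
    using le[OF that assms] le[OF assms that] by simp
  with assms show ?thesis unfolding pareto_mu_def by (rule the_equality)
qed

theorem theorem4p2:
  fixes G :: "'n::finite pair_pre_digraph"
  assumes "pair_graph G"
    and "pverts G = UNIV"
    and "Digraph_Component.connected (with_proj G)"
    and "\<not> complete_digraph (card (pverts G)) (with_proj G)"
  shows "is_kth_smallest 4 (distance_pareto_eigenvalues G) (1 + sqrt 3)
    \<and> pareto_mu 4 G = 1 + sqrt 3"
proof -
  interpret pair_graph G by fact
  \<comment> \<open>Connectedness concerns the symmetric closure, which has the same reachability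
    because the arcs are already symmetric.\<close>
  have reach: "u \<rightarrow>\<^sup>*\<^bsub>G\<^esub> v" for u v
    using assms(2,3) reachable_mk_symmetric_eq[OF pair_sym_arcs]
    by (auto simp: connected_def strongly_connected_def)
  obtain u v where "u \<noteq> v" "(u, v) \<notin> parcs G"
    using assms(2,4) pair_no_loops[of "(w, w)" for w]
    by (auto simp: complete_digraph_pair_def)
  then obtain a b c where abc: "(a, b) \<in> parcs G" "(b, c) \<in> parcs G" "(a, c) \<notin> parcs G" "a \<noteq> c"
    using obtain_induced_path3[OF reach] by metis
  have d: "graph_dist G a b = 1" "graph_dist G b c = 1" "graph_dist G a c = 2"
    using abc graph_dist_eq_1_iff[OF reach] graph_dist_eq_2I by auto
  have "a \<noteq> b" using abc pair_no_loops by fastforce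
  let ?E = "distance_pareto_eigenvalues G"
  note zero = graph_dist_eq_0_iff[OF reach]
  have E: "l \<in> ?E \<longleftrightarrow> pareto_eigenvalue (\<chi> i j. real (graph_dist G i j)) l" for l
    by (simp add: distance_pareto_eigenvalues_def distance_matrix_def)
  \<comment> \<open>The four values come from a single vertex, the adjacent pair \<open>a\<close>,
    \<open>b\<close>, the pair \<open>a\<close>, \<open>c\<close> at distance 2, and the whole
    path.\<close>
  have mem: "0 \<in> ?E" "1 \<in> ?E" "2 \<in> ?E" "1 + sqrt 3 \<in> ?E"
    using pareto_dmat_0[OF zero graph_dist_sym] pareto_dmat_path3[OF zero graph_dist_sym d]
      pareto_dmat_entry[OF zero graph_dist_sym \<open>a \<noteq> b\<close>]
      pareto_dmat_entry[OF zero graph_dist_sym \<open>a \<noteq> c\<close>] d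
    by (simp_all add: E)
  have gt2: "2 < 1 + sqrt 3" by simp
  then have neq: "0 \<noteq> 1 + sqrt 3" "1 \<noteq> 1 + sqrt 3" "2 \<noteq> 1 + sqrt 3" by linarith+
  have "{y \<in> ?E. y \<le> 1 + sqrt 3} = {0, 1, 2, 1 + sqrt 3}"
    using mem gt2 pareto_dmat_small[OF zero graph_dist_sym] unfolding E by auto
  moreover have "card {0, 1, 2, 1 + sqrt 3 :: real} = 4" by (simp add: neq)
  ultimately have "is_kth_smallest 4 ?E (1 + sqrt 3)"
    using mem by (simp add: is_kth_smallest_def)
  then show ?thesis using pareto_mu_eqI by blast
qed

end
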